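(* Let $D$ be an arbitrary complex $n \times n$ matrix, $n \ge 2$, and let $U$ be a random matrix uniformly distributed (Haar measure) over the unitary group $U(n)$. Then $$\mathbb{P}\big(s_n(D+U) \le t\big) \le t^c n^C \qquad \text{for all } t > 0,$$ where $c, C > 0$ are absolute constants.
   Context: $s_n(M) = \min_{x \in \mathbb{C}^n, \|x\|_2 = 1}\|Mx\|_2$ denotes the smallest singular value of an $n\times n$ matrix $M$. *)

theory Defs
  imports "HOL-Probability.Probability"
begin

text \<open>Complex n x n matrices are represented as functions nat => nat => complex,
  with indices 0..n-1; vectors in C^n as functions nat => complex (indices 0..n-1).
  This explicit-carrier encoding is needed because the constants c, C must be
  uniform in n.\<close>

type_synonym cmatrix = "nat \<Rightarrow> nat \<Rightarrow> complex"

definition cmat :: "nat \<Rightarrow> cmatrix set" where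
  "cmat n = {A. \<forall>i j. (n \<le> i \<or> n \<le> j) \<longrightarrow> A i j = 0}"

definition mmult :: "nat \<Rightarrow> cmatrix \<Rightarrow> cmatrix \<Rightarrow> cmatrix" where
  "mmult n A B = (\<lambda>i j. if i < n \<and> j < n then (\<Sum>k<n. A i k * B k j) else 0)"

definition madd :: "nat \<Rightarrow> cmatrix \<Rightarrow> cmatrix \<Rightarrow> cmatrix" where
  "madd n A B = (\<lambda>i j. if i < n \<and> j < n then A i j + B i j else 0)"

text \<open>U is unitary: U^* U = I (for square matrices equivalent to U U^* = I).\<close>
definition unitary :: "nat \<Rightarrow> cmatrix set" where
  "unitary n = {U \<in> cmat n. \<forall>i<n. \<forall>j<n.
      (\<Sum>k<n. cnj (U k i) * U k j) = (if i = j then 1 else 0)}"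

definition mvec :: "nat \<Rightarrow> cmatrix \<Rightarrow> (nat \<Rightarrow> complex) \<Rightarrow> (nat \<Rightarrow> complex)" where
  "mvec n A x = (\<lambda>i. if i < n then (\<Sum>j<n. A i j * x j) else 0)"

definition vnorm :: "nat \<Rightarrow> (nat \<Rightarrow> complex) \<Rightarrow> real" where
  "vnorm n x = sqrt (\<Sum>i<n. (cmod (x i))\<^sup>2)"

definition smin :: "nat \<Rightarrow> cmatrix \<Rightarrow> real" where
  "smin n A = Inf ((\<lambda>x. vnorm n (mvec n A x)) ` {x. (\<forall>i\<ge>n. x i = 0) \<and> vnorm n x = 1})"

text \<open>M is (the distribution of) the Haar probability measure on U(n): a Borel
  probability measure on n x n complex matrices, concentrated on U(n), and
  invariant under left multiplication by every unitary matrix.  (By uniqueness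
  of Haar measure on the compact group U(n), this characterizes it.)\<close>
definition haar_unitary :: "nat \<Rightarrow> cmatrix measure \<Rightarrow> bool" where
  "haar_unitary n M \<longleftrightarrow>
     prob_space M \<and> sets M = sets borel \<and>
     (AE U in M. U \<in> unitary n) \<and>
     (\<forall>V \<in> unitary n. \<forall>A \<in> sets M.
        emeasure M ((\<lambda>U. mmult n V U) -` A \<inter> space M) = emeasure M A)"

end

theory Submission
  imports Defs "Jordan_Normal_Form.Char_Poly"
begin

text \<open>
  Put \<open>N = U (D + U)\<^sup>-\<^sup>1\<close>; almost surely \<open>D + U\<close> is invertible, since \<open>U\<close> and \<open>z U\<close> have the same
  law for \<open>\<bar>z\<bar> = 1\<close> and \<open>D + z U\<close> is singular for at most \<open>n\<close> values of \<open>z\<close>. For a fixed vector \<open>w\<close>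
  replace \<open>U\<close> by \<open>V U\<close>, where the unitary \<open>V\<close> multiplies the line through \<open>w\<close> by a random phase
  \<open>u\<close> and fixes its orthogonal complement. By the Sherman-Morrison formula \<open>\<bar>w\<^sup>* N w\<bar>\<close> becomes
  \<open>\<parallel>w\<parallel>\<^sup>2 / \<bar>u + a\<bar>\<close> with \<open>a\<close> independent of \<open>u\<close>, so it exceeds \<open>r\<close> with probability at most
  \<open>2 \<parallel>w\<parallel>\<^sup>2 / r\<close>. By polarization the quadratic form at \<open>4 n\<^sup>2\<close> fixed vectors controls all entries
  of \<open>N\<close>, hence its norm, which is the reciprocal of the smallest singular value of \<open>D + U\<close>.
  Sampling the phases at the points \<open>(1 + \<i> k / m) / (1 - \<i> k / m)\<close>, \<open>k < m\<close>, replaces Fubini's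
  theorem by counting.
\<close>

subsection \<open>Determinants and adjugates\<close>

definition to_mat :: "nat \<Rightarrow> cmatrix \<Rightarrow> complex mat" where
  "to_mat n A = mat n n (\<lambda>(i, j). A i j)"

definition mdet :: "nat \<Rightarrow> cmatrix \<Rightarrow> complex" where
  "mdet n A = Determinant.det (to_mat n A)"

text \<open>Entries with an index outside the range below \<open>n\<close> are left unspecified;
  this is harmless because \<open>mvec\<close> and \<open>mmult\<close> read only indices below
  \<open>n\<close>.\<close>

definition madj :: "nat \<Rightarrow> cmatrix \<Rightarrow> cmatrix" where
  "madj n A i j = adj_mat (to_mat n A) $$ (i, j)"

lemma to_mat_carrier [simp]: "to_mat n A \<in> carrier_mat n n"
  by (simp add: to_mat_def)

lemma dim_to_mat [simp]: "dim_row (to_mat n A) = n" "dim_col (to_mat n A) = n"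
  by (simp_all add: to_mat_def)

lemma index_to_mat [simp]: "i < n \<Longrightarrow> j < n \<Longrightarrow> to_mat n A $$ (i, j) = A i j"
  by (simp add: to_mat_def)

lemma madj_left:
  assumes "i < n" "j < n"
  shows "(\<Sum>k<n. madj n A i k * A k j) = (if i = j then mdet n A else 0)"
proof -
  have "(adj_mat (to_mat n A) * to_mat n A) $$ (i, j) = (\<Sum>k<n. madj n A i k * A k j)"
    using assms adj_mat(1)[of "to_mat n A" n]
    by (auto simp: madj_def scalar_prod_def atLeast0LessThan intro!: sum.cong)
  then show ?thesis
    using assms by (auto simp: adj_mat(3)[of _ n] mdet_def split: if_splits)
qed

lemma madj_right:
  assumes "i < n" "j < n"
  shows "(\<Sum>k<n. A i k * madj n A k j) = (if i = j then mdet n A else 0)"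
proof -
  have "(to_mat n A * adj_mat (to_mat n A)) $$ (i, j) = (\<Sum>k<n. A i k * madj n A k j)"
    using assms adj_mat(1)[of "to_mat n A" n]
    by (auto simp: madj_def scalar_prod_def atLeast0LessThan intro!: sum.cong)
  then show ?thesis
    using assms by (auto simp: adj_mat(2)[of _ n] mdet_def split: if_splits)
qed

text \<open>By the Leibniz formula the determinant is a polynomial in the entries.\<close>

lemma borel_measurable_mdet:
  assumes "\<And>i j. i < n \<Longrightarrow> j < n \<Longrightarrow> (\<lambda>x. F x i j) \<in> borel_measurable M"
  shows "(\<lambda>x. mdet n (F x)) \<in> borel_measurable M"
proof -
  have "(\<lambda>x. mdet n (F x)) =
      (\<lambda>x. \<Sum>p\<in>{p. p permutes {0..<n}}. signof p * (\<Prod>i = 0..<n. F x i (p i)))"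
    by (auto simp: mdet_def Determinant.det_def fun_eq_iff intro!: sum.cong prod.cong
        dest: permutes_in_image[of _ "{0..<n}"])
  also have "\<dots> \<in> borel_measurable M"
  proof (intro borel_measurable_sum borel_measurable_times borel_measurable_const
      borel_measurable_prod)
    fix p i assume "p \<in> {p. p permutes {0..<n}}" "i \<in> {0..<n}"
    then show "(\<lambda>x. F x i (p i)) \<in> borel_measurable M"
      using assms permutes_in_image[of p "{0..<n}" i] by simp
  qed
  finally show ?thesis .
qed

text \<open>Up to sign an adjugate entry is a minor; \<open>?G\<close> deletes row \<open>j\<close>
  and column \<open>i\<close> by shifting indices.\<close>

lemma borel_measurable_madj:
  assumes F: "\<And>i j. i < n \<Longrightarrow> j < n \<Longrightarrow> (\<lambda>x. F x i j) \<in> borel_measurable M"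
    and "i < n" "j < n"
  shows "(\<lambda>x. madj n (F x) i j) \<in> borel_measurable M"
proof -
  let ?G = "\<lambda>x a b. F x (if a < j then a else Suc a) (if b < i then b else Suc b)"
  have "mat_delete (to_mat n (F x)) j i = to_mat (n - 1) (?G x)" for x
    by (rule eq_matI) (auto simp: mat_delete_def to_mat_def)
  then have "(\<lambda>x. madj n (F x) i j) = (\<lambda>x. (- 1) ^ (j + i) * mdet (n - 1) (?G x))"
    using assms(2,3) by (auto simp: madj_def adj_mat_def cofactor_def mdet_def)
  also have "\<dots> \<in> borel_measurable M"
    by (intro borel_measurable_times borel_measurable_const borel_measurable_mdet F) auto
  finally show ?thesis .
qed

text \<open>If \<open>D + z U\<close> is singular, then \<open>- z\<close> is an eigenvalue of \<open>U\<^sup>* D\<close>.\<close>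

lemma card_singular_pencil_le:
  assumes U: "U \<in> unitary n"
  shows "finite {z. mdet n (\<lambda>i j. D i j + z * U i j) = 0}"
    and "card {z. mdet n (\<lambda>i j. D i j + z * U i j) = 0} \<le> n"
proof -
  define H where "H = to_mat n (\<lambda>i j. cnj (U j i))"
  have H: "H \<in> carrier_mat n n" by (simp add: H_def)
  have HU: "H * to_mat n U = 1\<^sub>m n"
    using U by (intro eq_matI) (auto simp: H_def scalar_prod_def unitary_def atLeast0LessThan)
  let ?E = "H * to_mat n D"
  have E: "?E \<in> carrier_mat n n" using H by simp
  let ?S = "{z. mdet n (\<lambda>i j. D i j + z * U i j) = 0}"
  let ?R = "{z. poly (char_poly ?E) z = 0}"
  have "- z \<in> ?R" if "z \<in> ?S" for z
  proof -
    let ?X = "to_mat n (\<lambda>i j. D i j + z * U i j)"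
    have X: "?X = to_mat n D + z \<cdot>\<^sub>m to_mat n U"
      by (rule eq_matI) auto
    from that have "Determinant.det ?X = 0" by (simp add: mdet_def)
    then obtain v where v: "v \<in> carrier_vec n" "v \<noteq> 0\<^sub>v n" "?X *\<^sub>v v = 0\<^sub>v n"
      by (auto simp: det_0_iff_vec_prod_zero_field[of _ n])
    \<comment> \<open>\<open>H\<close> is the conjugate transpose of \<open>U\<close>, so it turns
      the pencil into \<open>?E\<close> plus \<open>z\<close> times the identity, and a kernel
      vector into an eigenvector of \<open>?E\<close> for \<open>- z\<close>.\<close>
    have HX: "H * ?X = ?E + z \<cdot>\<^sub>m 1\<^sub>m n"
      unfolding X using H
      by (simp add: mult_add_distrib_mat[of _ n n _ n] mult_smult_distrib[of _ n n _ n] HU)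
    have "(?E + z \<cdot>\<^sub>m 1\<^sub>m n) *\<^sub>v v = H *\<^sub>v (?X *\<^sub>v v)"
      unfolding HX[symmetric] by (rule assoc_mult_mat_vec[OF H to_mat_carrier v(1)])
    also have "\<dots> = 0\<^sub>v n"
      unfolding v(3) using H by (intro eq_vecI) (auto simp: scalar_prod_def)
    moreover have smult_one: "(z \<cdot>\<^sub>m 1\<^sub>m n) *\<^sub>v v = z \<cdot>\<^sub>v v"
      using v(1) by (intro eq_vecI) (auto simp: scalar_prod_def if_distrib if_distribR
          sum.delta' cong: if_cong)
    ultimately have *: "?E *\<^sub>v v + z \<cdot>\<^sub>v v = 0\<^sub>v n"
      using E v(1) by (simp add: add_mult_distrib_mat_vec[of _ n n] smult_one)
    have "?E *\<^sub>v v = (- z) \<cdot>\<^sub>v v"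
    proof (rule eq_vecI)
      show "dim_vec (?E *\<^sub>v v) = dim_vec ((- z) \<cdot>\<^sub>v v)" using E v(1) by auto
    next
      fix i assume "i < dim_vec ((- z) \<cdot>\<^sub>v v)"
      then have i: "i < n" using v(1) by auto
      have "vec_index (?E *\<^sub>v v + z \<cdot>\<^sub>v v) i = 0" using i unfolding * by simp
      then show "vec_index (?E *\<^sub>v v) i = vec_index ((- z) \<cdot>\<^sub>v v) i"
        using i v(1) E by (simp add: eq_neg_iff_add_eq_0 del: index_mult_mat_vec)
    qed
    then have "eigenvalue ?E (- z)"
      using v(1,2) carrier_matD(1)[OF E] unfolding eigenvalue_def eigenvector_def
      by (intro exI[of _ v]) (simp only: simp_thms)
    then show ?thesis using eigenvalue_root_char_poly[OF E] by simp
  qed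
  then have sub: "?S \<subseteq> uminus ` ?R" by force
  have deg: "degree (char_poly ?E) = n" "char_poly ?E \<noteq> 0"
    using degree_monic_char_poly[OF E] by auto
  then have R: "finite ?R" "card ?R \<le> n"
    using card_poly_roots_bound[of "char_poly ?E"] by (auto intro: poly_roots_finite)
  show "finite ?S" using sub R by (meson finite_imageI finite_subset)
  have "card ?S \<le> card (uminus ` ?R)" using sub R by (intro card_mono) auto
  also have "\<dots> \<le> card ?R" using R by (intro card_image_le)
  finally show "card ?S \<le> n" using R by simp
qed

subsection \<open>Vectors and unitary matrices\<close>

definition cdot :: "nat \<Rightarrow> (nat \<Rightarrow> complex) \<Rightarrow> (nat \<Rightarrow> complex) \<Rightarrow> complex" where
  "cdot n x y = (\<Sum>i<n. cnj (x i) * y i)"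

lemma cdot_self: "cdot n x x = of_real ((vnorm n x)\<^sup>2)"
  by (simp add: cdot_def vnorm_def real_sqrt_pow2 sum_nonneg complex_norm_square mult.commute
      del: of_real_power)

lemma cdot_cong: "(\<And>i. i < n \<Longrightarrow> y i = z i) \<Longrightarrow> cdot n x y = cdot n x z"
  by (simp add: cdot_def)

lemma cdot_add: "cdot n x (\<lambda>i. y i + z i) = cdot n x y + cdot n x z"
  by (simp add: cdot_def ring_distribs sum.distrib)

lemma cdot_scale: "cdot n x (\<lambda>i. c * y i) = c * cdot n x y"
  by (simp add: cdot_def sum_distrib_left ac_simps)

lemma vnorm_eq_0_iff: "vnorm n x = 0 \<longleftrightarrow> (\<forall>i<n. x i = 0)"
  by (auto simp: vnorm_def sum_nonneg_eq_0_iff)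

lemma mvec_cong: "(\<And>i. i < n \<Longrightarrow> x i = y i) \<Longrightarrow> mvec n A x = mvec n A y"
  by (auto simp: mvec_def fun_eq_iff)

lemma mvec_scale: "mvec n A (\<lambda>i. c * x i) = (\<lambda>i. c * mvec n A x i)"
  by (auto simp: mvec_def fun_eq_iff sum_distrib_left ac_simps)

lemma mvec_madd: "mvec n (madd n A B) x = (\<lambda>i. mvec n A x i + mvec n B x i)"
  by (auto simp: mvec_def madd_def fun_eq_iff sum.distrib ring_distribs)

lemma mvec_mmult: "mvec n (mmult n A B) x = mvec n A (mvec n B x)"
proof
  fix i
  have "(\<Sum>j<n. (\<Sum>k<n. A i k * B k j) * x j) = (\<Sum>k<n. A i k * (\<Sum>j<n. B k j * x j))"
    by (simp add: sum_distrib_left sum_distrib_right mult.assoc) (rule sum.swap)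
  then show "mvec n (mmult n A B) x i = mvec n A (mvec n B x) i"
    by (simp add: mvec_def mmult_def)
qed

text \<open>The adjugate stands in for the inverse: singular matrices need no separate case, and
  division by the determinant is postponed.\<close>

lemma mvec_madj_left: "i < n \<Longrightarrow> mvec n (madj n A) (mvec n A x) i = mdet n A * x i"
proof -
  assume i: "i < n"
  have "mvec n (madj n A) (mvec n A x) i = (\<Sum>j<n. (\<Sum>k<n. madj n A i k * A k j) * x j)"
    unfolding mvec_mmult[symmetric] using i by (simp add: mvec_def mmult_def)
  also have "\<dots> = (\<Sum>j<n. if i = j then mdet n A * x j else 0)"
    using i by (intro sum.cong) (auto simp: madj_left)
  finally show ?thesis using i by simp
qed

lemma mvec_madj_right: "i < n \<Longrightarrow> mvec n A (mvec n (madj n A) x) i = mdet n A * x i"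
proof -
  assume i: "i < n"
  have "mvec n A (mvec n (madj n A) x) i = (\<Sum>j<n. (\<Sum>k<n. A i k * madj n A k j) * x j)"
    unfolding mvec_mmult[symmetric] using i by (simp add: mvec_def mmult_def)
  also have "\<dots> = (\<Sum>j<n. if i = j then mdet n A * x j else 0)"
    using i by (intro sum.cong) (auto simp: madj_right)
  finally show ?thesis using i by simp
qed

lemma vnorm_mvec_unitary:
  assumes "U \<in> unitary n"
  shows "vnorm n (mvec n U x) = vnorm n x"
proof -
  have "cdot n (mvec n U x) (mvec n U x)
      = (\<Sum>k<n. \<Sum>i<n. \<Sum>j<n. cnj (U k i) * cnj (x i) * (U k j * x j))"
    by (simp add: cdot_def mvec_def sum_product)
  also have "\<dots> = (\<Sum>i<n. \<Sum>j<n. \<Sum>k<n. cnj (U k i) * cnj (x i) * (U k j * x j))"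
    by (subst sum.swap) (intro sum.cong refl sum.swap)
  also have "\<dots> = (\<Sum>i<n. \<Sum>j<n. cnj (x i) * x j * (\<Sum>k<n. cnj (U k i) * U k j))"
    by (simp add: sum_distrib_left ac_simps)
  also have "\<dots> = (\<Sum>i<n. \<Sum>j<n. if i = j then cnj (x i) * x j else 0)"
    using assms by (intro sum.cong refl) (simp add: unitary_def)
  also have "\<dots> = cdot n x x" by (simp add: cdot_def)
  finally have "(vnorm n (mvec n U x))\<^sup>2 = (vnorm n x)\<^sup>2"
    unfolding cdot_self of_real_eq_iff .
  then show ?thesis by (simp add: vnorm_def sum_nonneg)
qed

section \<open>Phases on an arc of the unit circle and unitaries built from phases\<close>

definition cayley :: "real \<Rightarrow> complex" where
  "cayley s = (1 + \<i> * s) / (1 - \<i> * s)"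

lemma cayley_denom_nonzero: "1 - \<i> * complex_of_real s \<noteq> 0"
  by (simp add: complex_eq_iff)

lemma norm_cayley [simp]: "cmod (cayley s) = 1"
proof -
  have "cmod (1 + \<i> * s) = cmod (1 - \<i> * s)" by (simp add: cmod_def)
  then show ?thesis using cayley_denom_nonzero[of s] by (simp add: cayley_def norm_divide)
qed

text \<open>The difference is \<open>2 * \<i> * (s - t)\<close> over a product of two factors of
  modulus at most \<open>sqrt 2\<close>. Hence the phases sampled at \<open>k / m\<close> are at
  least as far apart as their parameters.\<close>

lemma cayley_expanding:
  assumes "\<bar>s\<bar> \<le> 1" "\<bar>t\<bar> \<le> 1"
  shows "\<bar>s - t\<bar> \<le> cmod (cayley s - cayley t)"
proof -
  have "cayley s - cayley t = 2 * \<i> * of_real (s - t) / ((1 - \<i> * s) * (1 - \<i> * t))"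
    using cayley_denom_nonzero[of s] cayley_denom_nonzero[of t]
    by (simp add: cayley_def field_simps)
  then have eq: "cmod (cayley s - cayley t)
      = 2 * \<bar>s - t\<bar> / (cmod (1 - \<i> * s) * cmod (1 - \<i> * t))"
    by (simp add: norm_divide norm_mult del: of_real_diff)
  have *: "cmod (1 - \<i> * r) \<le> sqrt 2" if "\<bar>r\<bar> \<le> 1" for r :: real
    using that by (simp add: cmod_def abs_square_le_1)
  have "cmod (1 - \<i> * s) * cmod (1 - \<i> * t) \<le> sqrt 2 * sqrt 2"
    using assms by (intro mult_mono *) auto
  moreover have "0 < cmod (1 - \<i> * s) * cmod (1 - \<i> * t)"
    using cayley_denom_nonzero[of s] cayley_denom_nonzero[of t] by simp
  ultimately show ?thesis unfolding eq
    by (simp add: le_divide_eq mult.commute[of _ "\<bar>s - t\<bar>"] mult_left_mono)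
qed

text \<open>The unitary that multiplies the line spanned by \<open>w\<close> by the phase \<open>u\<close> and fixes the
  orthogonal complement; for \<open>w = 0\<close> it degenerates to the identity.\<close>

definition line_phase :: "nat \<Rightarrow> (nat \<Rightarrow> complex) \<Rightarrow> complex \<Rightarrow> cmatrix" where
  "line_phase n w u = (\<lambda>i j. if i < n \<and> j < n
     then (if i = j then 1 else 0) + (u - 1) / cdot n w w * (w i * cnj (w j)) else 0)"

lemma mvec_line_phase:
  assumes "i < n"
  shows "mvec n (line_phase n w u) x i = x i + (u - 1) / cdot n w w * cdot n w x * w i"
proof -
  have "mvec n (line_phase n w u) x i = (\<Sum>j<n. (if i = j then x j else 0)
      + (u - 1) / cdot n w w * w i * (cnj (w j) * x j))"
    using assms unfolding mvec_def line_phase_def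
    by (auto intro!: sum.cong simp: algebra_simps)
  also have "\<dots> = x i + (u - 1) / cdot n w w * w i * cdot n w x"
    using assms by (simp add: sum.distrib cdot_def sum_distrib_left)
  finally show ?thesis by (simp add: ac_simps)
qed

lemma line_phase_unitary:
  assumes "cmod u = 1"
  shows "line_phase n w u \<in> unitary n"
proof -
  define W where "W = cdot n w w"
  define a where "a = (u - 1) / W"
  have W: "cnj W = W" by (simp add: W_def cdot_self)
  have uu: "cnj u * u = 1" using assms by (simp add: complex_norm_square[symmetric] mult.commute)
  \<comment> \<open>For \<open>V = 1 + a w w*\<close>, the matrix \<open>V* V - 1\<close> is this
    number times \<open>w w*\<close>, so unitarity amounts to its vanishing.\<close>
  have key: "a + cnj a + cnj a * a * W = 0"
  proof (cases "W = 0")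
    case False
    then have "(a + cnj a + cnj a * a * W) * W = (u - 1) + cnj (u - 1) + cnj (u - 1) * (u - 1)"
      by (simp add: a_def W field_simps)
    also have "\<dots> = 0" using uu by (simp add: algebra_simps)
    finally show ?thesis using False by simp
  \<comment> \<open>When \<open>W = 0\<close>, division by zero gives \<open>a = 0\<close>.\<close>
  qed (simp add: a_def)
  have L: "line_phase n w u k l = (if k = l then 1 else 0) + a * (w k * cnj (w l))"
    if "k < n" "l < n" for k l
    using that by (simp add: line_phase_def a_def W_def)
  have "(\<Sum>k<n. cnj (line_phase n w u k i) * line_phase n w u k j) = (if i = j then 1 else 0)"
    if ij: "i < n" "j < n" for i j
  proof -
    have "(\<Sum>k<n. cnj (line_phase n w u k i) * line_phase n w u k j)
      = (\<Sum>k<n. (if k = i then if i = j then 1 else 0 else 0)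
          + (if k = i then a * (w i * cnj (w j)) else 0)
          + (if k = j then cnj a * (w i * cnj (w j)) else 0)
          + cnj a * a * (w i * cnj (w j)) * (cnj (w k) * w k))"
      using ij by (intro sum.cong refl) (auto simp: L algebra_simps)
    also have "\<dots> = (if i = j then 1 else 0) + (a + cnj a + cnj a * a * W) * (w i * cnj (w j))"
      unfolding sum.distrib sum_distrib_left[symmetric] cdot_def[symmetric] W_def[symmetric]
      using ij by (simp add: algebra_simps)
    finally show ?thesis unfolding key by simp
  qed
  then show ?thesis by (auto simp: unitary_def cmat_def line_phase_def)
qed

definition scalar_mat :: "nat \<Rightarrow> complex \<Rightarrow> cmatrix" where
  "scalar_mat n u = (\<lambda>i j. if i < n \<and> j = i then u else 0)"

lemma scalar_mat_unitary: "cmod u = 1 \<Longrightarrow> scalar_mat n u \<in> unitary n"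
proof -
  assume "cmod u = 1"
  then have uu: "cnj u * u = 1" by (simp add: complex_norm_square[symmetric] mult.commute)
  have "(\<Sum>k<n. cnj (scalar_mat n u k i) * scalar_mat n u k j) = (if i = j then 1 else 0)"
    if "i < n" "j < n" for i j
  proof -
    have "(\<Sum>k<n. cnj (scalar_mat n u k i) * scalar_mat n u k j)
      = (\<Sum>k<n. if k = i then if i = j then 1 else 0 else 0)"
      using that uu by (intro sum.cong refl) (auto simp: scalar_mat_def)
    then show ?thesis using that by simp
  qed
  then show ?thesis by (auto simp: unitary_def cmat_def scalar_mat_def)
qed

lemma mmult_scalar_mat:
  assumes "i < n" "j < n"
  shows "mmult n (scalar_mat n u) A i j = u * A i j"
proof -
  have "(\<Sum>k<n. scalar_mat n u i k * A k j) = (\<Sum>k<n. if k = i then u * A k j else 0)"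
    using assms by (intro sum.cong) (auto simp: scalar_mat_def)
  then show ?thesis using assms by (simp add: mmult_def)
qed

text \<open>The integers from \<open>Min K\<close> to \<open>Max K\<close> number one more than the
  distance of the end points.\<close>

lemma card_bounded_diameter:
  fixes K :: "nat set"
  assumes "finite K" "0 \<le> d" and diam: "\<And>k l. k \<in> K \<Longrightarrow> l \<in> K \<Longrightarrow> \<bar>real k - real l\<bar> \<le> d"
  shows "real (card K) \<le> d + 1"
proof (cases "K = {}")
  case False
  have "card K \<le> card {Min K..Max K}"
    using assms(1) by (intro card_mono) auto
  moreover have "Min K \<in> K" "Max K \<in> K" "Min K \<le> Max K" using False assms(1) by auto
  moreover have "real (Max K) - real (Min K) \<le> d"
    using diam[of "Max K" "Min K"] calculation by linarith
  ultimately show ?thesis by (simp add: of_nat_diff)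
qed (use assms in simp)

subsection \<open>Haar averaging\<close>

lemma borel_measurable_matrix_entry:
  assumes "sets M = sets (borel :: cmatrix measure)"
  shows "(\<lambda>U. U i j) \<in> borel_measurable M"
proof -
  have "continuous_on UNIV (\<lambda>U :: cmatrix. U i j)"
    by (rule continuous_on_product_then_coordinatewise
        [OF continuous_on_product_then_coordinatewise[OF continuous_on_id]])
  then show ?thesis
    by (simp add: borel_measurable_continuous_onI measurable_cong_sets[OF assms refl])
qed

text \<open>Measurability into a countable product can be checked entry by entry, and each entry is
  linear in \<open>U\<close>.\<close>

lemma measurable_mmult:
  assumes "sets M = sets (borel :: cmatrix measure)"
  shows "mmult n V \<in> measurable M M"
proof -
  have "mmult n V \<in> measurable M borel"
  proof (rule measurable_coordinatewise_then_product)+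
    fix i j
    show "(\<lambda>U. mmult n V U i j) \<in> borel_measurable M"
      unfolding mmult_def
      by (cases "i < n \<and> j < n") (auto intro!: borel_measurable_sum borel_measurable_times
          borel_measurable_const borel_measurable_matrix_entry assms)
  qed
  then show ?thesis by (simp add: measurable_cong_sets[OF refl assms])
qed

text \<open>Averaging the invariance of the Haar measure over finitely many translations turns a
  pointwise counting bound into a bound on the probability.\<close>

lemma haar_unitary_average_le:
  assumes haar: "haar_unitary n M" and E: "E \<in> sets M" and K: "finite K"
    and V: "\<And>k. k \<in> K \<Longrightarrow> V k \<in> unitary n"
    and count: "\<And>U. U \<in> unitary n \<Longrightarrow> real (card {k \<in> K. mmult n (V k) U \<in> E}) \<le> b"
  shows "real (card K) * measure M E \<le> b"
proof -
  interpret prob_space M using haar by (simp add: haar_unitary_def)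
  have M: "sets M = sets borel" "AE U in M. U \<in> unitary n"
    using haar by (auto simp: haar_unitary_def)
  have sp: "space M = UNIV" using sets_eq_imp_space_eq[OF M(1)] by simp
  define P where "P k = mmult n (V k) -` E \<inter> space M" for k
  have P: "P k \<in> sets M" for k
    unfolding P_def using measurable_mmult[OF M(1)] E by (rule measurable_sets)
  have mP: "measure M (P k) = measure M E" if "k \<in> K" for k
    using haar V[OF that] E by (auto simp: haar_unitary_def P_def measure_def)
  have ind: "integrable M (indicat_real (P k))" for k
    using P by (intro integrable_real_indicator) (auto simp: less_top[symmetric])
  have "real (card K) * measure M E = (\<Sum>k\<in>K. measure M (P k))"
    by (simp add: mP)
  also have "\<dots> = (\<integral>U. (\<Sum>k\<in>K. indicator (P k) U) \<partial>M)"
    using ind sp by (subst Bochner_Integration.integral_sum) auto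
  also have "\<dots> \<le> (\<integral>U. b \<partial>M)"
  proof (rule integral_mono_AE)
    show "AE U in M. (\<Sum>k\<in>K. indicator (P k) U) \<le> b"
      using M(2)
    proof eventually_elim
      case (elim U)
      have "(\<Sum>k\<in>K. indicator (P k) U) = real (card {k \<in> K. mmult n (V k) U \<in> E})"
        using K by (simp add: indicator_def P_def sp sum.If_cases Int_def)
      then show ?case using count[OF elim] by simp
    qed
  qed (use ind in auto)
  also have "\<dots> = b" by (simp add: prob_space)
  finally show ?thesis .
qed

text \<open>Divide by \<open>m\<close> and let \<open>m\<close> grow: the discretization error
  \<open>b\<close> disappears.\<close>

lemma bound_from_averages:
  fixes p a b :: real
  assumes "\<And>m :: nat. m > 0 \<Longrightarrow> real m * p \<le> a * real m + b"
  shows "p \<le> a"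
proof (rule ccontr)
  assume "\<not> p \<le> a"
  then obtain m :: nat where m: "b < real m * (p - a)"
    using reals_Archimedean3[of "p - a"] by auto
  show False
    using assms[of "Suc m"] m \<open>\<not> p \<le> a\<close> by (simp add: algebra_simps)
qed

section \<open>Measurability, and the null event that \<open>D + U\<close> is singular\<close>

lemma borel_measurable_mvec:
  assumes "\<And>i j. i < n \<Longrightarrow> j < n \<Longrightarrow> (\<lambda>x. F x i j) \<in> borel_measurable M"
    and "\<And>j. j < n \<Longrightarrow> (\<lambda>x. y x j) \<in> borel_measurable M"
  shows "(\<lambda>x. mvec n (F x) (y x) i) \<in> borel_measurable M"
proof (cases "i < n")
  case True
  have "(\<lambda>x. \<Sum>j<n. F x i j * y x j) \<in> borel_measurable M"
    by (intro borel_measurable_sum borel_measurable_times assms True) simp_all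
  then show ?thesis using True by (simp add: mvec_def)
qed (simp add: mvec_def)

lemma borel_measurable_madd_entry:
  assumes "sets M = sets (borel :: cmatrix measure)"
  shows "(\<lambda>U. madd n D U i j) \<in> borel_measurable M"
  using borel_measurable_matrix_entry[OF assms, of i j]
  by (cases "i < n \<and> j < n") (simp_all add: madd_def)

lemma borel_measurable_mdet_madd:
  assumes "sets M = sets (borel :: cmatrix measure)"
  shows "(\<lambda>U. mdet n (madd n D U)) \<in> borel_measurable M"
  by (intro borel_measurable_mdet borel_measurable_madd_entry assms)

lemma singular_measurable:
  assumes "sets M = sets (borel :: cmatrix measure)"
  shows "{U \<in> space M. mdet n (madd n D U) = 0} \<in> sets M"
proof -
  have "(\<lambda>U. mdet n (madd n D U)) -` {0} \<inter> space M \<in> sets M"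
    by (rule measurable_sets[OF borel_measurable_mdet_madd[OF assms]]) simp
  then show ?thesis by (simp add: vimage_def Int_def conj_commute)
qed

text \<open>Among \<open>m\<close> distinct scalar phases at most \<open>n\<close> make the pencil
  singular, so averaging gives \<open>m\<close> times the probability at most \<open>n\<close>; then
  \<open>m\<close> tends to infinity.\<close>

lemma haar_singular_null:
  assumes haar: "haar_unitary n M"
  shows "{U. mdet n (madd n D U) = 0} \<in> sets M"
    and "measure M {U. mdet n (madd n D U) = 0} = 0"
proof -
  let ?E = "{U. mdet n (madd n D U) = 0}"
  have M: "sets M = sets borel" using haar by (auto simp: haar_unitary_def)
  have sp: "space M = UNIV" using sets_eq_imp_space_eq[OF M] by simp
  show E: "?E \<in> sets M" using singular_measurable[OF M] by (simp add: sp)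
  have "real m * measure M ?E \<le> 0 * real m + real n" if m: "m > 0" for m :: nat
  proof -
    define V where "V k = scalar_mat n (cayley (real k / real m))" for k
    have "real (card {k \<in> {..<m}. mmult n (V k) U \<in> ?E}) \<le> real n" if U: "U \<in> unitary n" for U
    proof -
      let ?Z = "{z. mdet n (\<lambda>i j. D i j + z * U i j) = 0}"
      have eq: "mdet n (madd n D (mmult n (V k) U))
          = mdet n (\<lambda>i j. D i j + cayley (real k / real m) * U i j)" for k
        unfolding mdet_def
        by (intro arg_cong[of _ _ Determinant.det] eq_matI)
           (auto simp: madd_def V_def mmult_scalar_mat)
      have "inj_on (\<lambda>k. cayley (real k / real m)) {..<m}"
      proof (rule inj_onI)
        fix k l assume kl: "k \<in> {..<m}" "l \<in> {..<m}"
          and "cayley (real k / real m) = cayley (real l / real m)"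
        then have "\<bar>real k / real m - real l / real m\<bar> \<le> 0"
          using cayley_expanding[of "real k / real m" "real l / real m"] by auto
        then show "k = l" using m by simp
      qed
      then have "inj_on (\<lambda>k. cayley (real k / real m)) {k \<in> {..<m}. mmult n (V k) U \<in> ?E}"
        by (rule inj_on_subset) auto
      then have "card {k \<in> {..<m}. mmult n (V k) U \<in> ?E} \<le> card ?Z"
        by (rule card_inj_on_le) (auto simp: eq card_singular_pencil_le[OF U])
      then show ?thesis using card_singular_pencil_le(2)[OF U, of D] by simp
    qed
    then show ?thesis
      using haar_unitary_average_le[OF haar E, of "{..<m}" V "real n"]
      by (simp add: V_def scalar_mat_unitary)
  qed
  then have "measure M ?E \<le> 0" by (rule bound_from_averages)
  then show "measure M ?E = 0" using measure_nonneg[of M ?E] by linarith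
qed

text \<open>Where \<open>D + U\<close> is invertible, this says \<open>\<bar>w\<^sup>* U (D + U)\<^sup>-\<^sup>1 w\<bar> \<ge> r\<close>; clearing the
  denominator makes it visibly a Borel condition.\<close>

definition large_form :: "nat \<Rightarrow> cmatrix \<Rightarrow> (nat \<Rightarrow> complex) \<Rightarrow> real \<Rightarrow> cmatrix set" where
  "large_form n D w r = {U. mdet n (madd n D U) \<noteq> 0 \<and>
     r * cmod (mdet n (madd n D U)) \<le> cmod (cdot n w (mvec n U (mvec n (madj n (madd n D U)) w)))}"

lemma large_form_measurable:
  assumes M: "sets M = sets (borel :: cmatrix measure)"
  shows "large_form n D w r \<in> sets M"
proof -
  have sp: "space M = UNIV" using sets_eq_imp_space_eq[OF M] by simp
  note d = borel_measurable_mdet_madd[OF M, of n D] and d0 = singular_measurable[OF M, of n D]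
  have "(\<lambda>U. cdot n w (mvec n U (mvec n (madj n (madd n D U)) w))) \<in> borel_measurable M"
    unfolding cdot_def
    by (intro borel_measurable_sum borel_measurable_times borel_measurable_const
        borel_measurable_mvec borel_measurable_matrix_entry[OF M] borel_measurable_madj
        borel_measurable_madd_entry[OF M])
  then have "{U \<in> space M. mdet n (madd n D U) \<noteq> 0 \<and>
     r * cmod (mdet n (madd n D U)) \<le> cmod (cdot n w (mvec n U (mvec n (madj n (madd n D U)) w)))} \<in> sets M"
    using d by (intro sets.sets_Collect_conj sets.sets_Collect_neg d0
        borel_measurable_le borel_measurable_times borel_measurable_const
        measurable_compose[OF _ borel_measurable_norm])
  then show ?thesis by (simp add: large_form_def sp)
qed

text \<open>Here \<open>v\<close> is the solution of \<open>(D + U) v = w\<close>, obtained from the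
  adjugate. The last clause is uniqueness up to scaling, which lets solutions for two different
  phases be compared.\<close>

lemma large_formE:
  assumes "U \<in> large_form n D w r"
  obtains v where "\<And>i. i < n \<Longrightarrow> mvec n (madd n D U) v i = w i" "r \<le> cmod (cdot n w (mvec n U v))"
    "\<And>x c. (\<And>i. i < n \<Longrightarrow> mvec n (madd n D U) x i = c * w i) \<Longrightarrow> (\<And>i. i < n \<Longrightarrow> x i = c * v i)"
proof -
  define A where "A = madd n D U"
  have d: "mdet n A \<noteq> 0" using assms by (simp add: large_form_def A_def)
  have h: "r * cmod (mdet n A) \<le> cmod (cdot n w (mvec n U (mvec n (madj n A) w)))"
    using assms by (simp add: large_form_def A_def)
  define v where "v = (\<lambda>i. inverse (mdet n A) * mvec n (madj n A) w i)"
  show thesis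
  proof (rule that[of v]; (fold A_def)?)
    show "mvec n A v i = w i" if "i < n" for i
      using that d by (simp add: v_def mvec_scale mvec_madj_right)
    show "r \<le> cmod (cdot n w (mvec n U v))"
      using h d unfolding v_def mvec_scale cdot_scale norm_mult norm_inverse
      by (simp add: divide_inverse[symmetric] mult.commute[of "inverse _"] pos_le_divide_eq)
    fix x c i assume x: "\<And>i. i < n \<Longrightarrow> mvec n A x i = c * w i" and i: "i < n"
    have "mdet n A * x i = mvec n (madj n A) (mvec n A x) i"
      using i by (simp add: mvec_madj_left)
    also have "\<dots> = mvec n (madj n A) (\<lambda>i. c * w i) i"
      using mvec_cong[of n "mvec n A x" "\<lambda>i. c * w i"] x by simp
    also have "\<dots> = c * mvec n (madj n A) w i" by (simp add: mvec_scale)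
    finally show "x i = c * v i" using d by (simp add: v_def field_simps)
  qed
qed

text \<open>With \<open>q = w\<^sup>* U (D + U)\<^sup>-\<^sup>1 w\<close>, the Sherman-Morrison formula says that rotating \<open>U\<close> by the
  phase \<open>u\<close> along \<open>w\<close> changes \<open>\<parallel>w\<parallel>\<^sup>2 / q\<close> by \<open>u - 1\<close> up to a unimodular factor, so \<open>q\<close> is large
  only for phases \<open>u\<close> in a short arc.\<close>

lemma large_form_phase_close:
  assumes r: "0 < r" and u: "cmod u = 1" "cmod u' = 1"
    and U: "mmult n (line_phase n w u) U \<in> large_form n D w r"
    and U': "mmult n (line_phase n w u') U \<in> large_form n D w r"
  shows "cmod (u - u') \<le> 2 * (vnorm n w)\<^sup>2 / r"
proof -
  define W where "W = cdot n w w"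
  obtain v where v: "\<And>i. i < n \<Longrightarrow> mvec n (madd n D (mmult n (line_phase n w u) U)) v i = w i"
      "r \<le> cmod (cdot n w (mvec n (mmult n (line_phase n w u) U) v))"
      "\<And>x c i. (\<And>i. i < n \<Longrightarrow> mvec n (madd n D (mmult n (line_phase n w u) U)) x i = c * w i)
        \<Longrightarrow> i < n \<Longrightarrow> x i = c * v i"
    by (rule large_formE[OF U]) blast
  obtain v' where v': "\<And>i. i < n \<Longrightarrow> mvec n (madd n D (mmult n (line_phase n w u') U)) v' i = w i"
      "r \<le> cmod (cdot n w (mvec n (mmult n (line_phase n w u') U) v'))"
    by (rule large_formE[OF U']) blast
  \<comment> \<open>If \<open>w\<close> vanished, so would the form, against
    \<open>0 < r\<close>.\<close>
  have W0: "W \<noteq> 0"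
  proof
    assume "W = 0"
    then have "cdot n w x = 0" for x
      by (simp add: W_def cdot_self vnorm_eq_0_iff) (simp add: cdot_def)
    then show False using v(2) r by simp
  qed
  \<comment> \<open>The rotation acts on the left vector as a scalar:
    \<open>w* V = a w*\<close>.\<close>
  have form: "cdot n w (mvec n (mmult n (line_phase n w a) U) x) = a * cdot n w (mvec n U x)" for a x
  proof -
    have "cdot n w (mvec n (mmult n (line_phase n w a) U) x)
      = cdot n w (\<lambda>i. mvec n U x i + (a - 1) / W * cdot n w (mvec n U x) * w i)"
      by (intro cdot_cong) (simp add: mvec_mmult mvec_line_phase W_def)
    also have "\<dots> = a * cdot n w (mvec n U x)"
      unfolding cdot_add cdot_scale using W0 by (simp add: W_def[symmetric] field_simps)
    finally show ?thesis .
  qed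
  define b where "b = cdot n w (mvec n U v)"
  define b' where "b' = cdot n w (mvec n U v')"
  have rb: "r \<le> cmod b" "r \<le> cmod b'"
    using v(2) v'(2) u by (simp_all add: form norm_mult b_def b'_def)
  then have pos: "0 < cmod b" "0 < cmod b'" using r by linarith+
  \<comment> \<open>Switching the phase from \<open>u'\<close> to \<open>u\<close> changes the
    matrix only by a rank-one term with range spanned by \<open>w\<close>, so it sends
    \<open>v'\<close> to a multiple of \<open>w\<close>; this factor is \<open>c\<close>.\<close>
  define c where "c = 1 + (u - u') / W * b'"
  have "mvec n (madd n D (mmult n (line_phase n w u) U)) v' i = c * w i" if i: "i < n" for i
  proof -
    have "mvec n D v' i + (mvec n U v' i + (u' - 1) / W * b' * w i) = w i"
      using v'(1)[OF i] i by (simp add: mvec_madd mvec_mmult mvec_line_phase W_def b'_def)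
    moreover have "mvec n (madd n D (mmult n (line_phase n w u) U)) v' i
      = mvec n D v' i + (mvec n U v' i + (u - 1) / W * b' * w i)"
      using i by (simp add: mvec_madd mvec_mmult mvec_line_phase W_def b'_def)
    moreover have "(u - 1) / W = (u' - 1) / W + (u - u') / W"
      by (simp add: add_divide_distrib[symmetric])
    ultimately show ?thesis by (simp add: c_def algebra_simps)
  qed
  then have "\<And>i. i < n \<Longrightarrow> v' i = c * v i" by (rule v(3))
  then have "mvec n U v' = mvec n U (\<lambda>i. c * v i)" by (rule mvec_cong)
  then have "b' = c * b" by (simp add: b'_def b_def mvec_scale cdot_scale)
  \<comment> \<open>Equivalently \<open>u - u' = W * (1 / b - 1 / b')\<close>, and both reciprocals
    have modulus at most \<open>1 / r\<close>.\<close>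
  then have "(u - u') * (b * b') = W * (b' - b)"
    using W0 by (simp add: c_def field_simps)
  then have "cmod (u - u') * (cmod b * cmod b') = cmod W * cmod (b' - b)"
    by (metis norm_mult)
  also have "\<dots> \<le> cmod W * (cmod b' + cmod b)"
    by (intro mult_left_mono norm_triangle_ineq4) auto
  finally have "cmod (u - u') \<le> cmod W * (cmod b' + cmod b) / (cmod b * cmod b')"
    using pos by (simp add: pos_le_divide_eq)
  also have "\<dots> = cmod W * (1 / cmod b + 1 / cmod b')"
    using pos by (simp add: field_simps)
  also have "\<dots> \<le> cmod W * (1 / r + 1 / r)"
    using rb r pos by (intro mult_left_mono add_mono divide_left_mono) auto
  finally show ?thesis by (simp add: W_def cdot_self norm_power mult.commute)
qed

text \<open>The bad phases lie pairwise within \<open>?d\<close>, so the bad indices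
  \<open>k\<close> spread over at most \<open>?d * m\<close>, and there are at most
  \<open>?d * m + 1\<close> of them out of \<open>m\<close>.\<close>

lemma haar_large_form_le:
  assumes haar: "haar_unitary n M" and r: "0 < r"
  shows "measure M (large_form n D w r) \<le> 2 * (vnorm n w)\<^sup>2 / r"
proof (rule bound_from_averages)
  fix m :: nat assume m: "m > 0"
  have M: "sets M = sets borel" using haar by (auto simp: haar_unitary_def)
  define V where "V k = line_phase n w (cayley (real k / real m))" for k
  let ?E = "large_form n D w r"
  let ?d = "2 * (vnorm n w)\<^sup>2 / r"
  have "real (card {k \<in> {..<m}. mmult n (V k) U \<in> ?E}) \<le> ?d * real m + 1" for U
  proof (rule card_bounded_diameter)
    fix k l assume kl: "k \<in> {k \<in> {..<m}. mmult n (V k) U \<in> ?E}" "l \<in> {k \<in> {..<m}. mmult n (V k) U \<in> ?E}"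
    have "\<bar>real k / real m - real l / real m\<bar> \<le> cmod (cayley (real k / real m) - cayley (real l / real m))"
      using kl by (intro cayley_expanding) auto
    also have "\<dots> \<le> ?d"
      using kl by (intro large_form_phase_close[OF r, where U = U and D = D]) (auto simp: V_def)
    finally show "\<bar>real k - real l\<bar> \<le> ?d * real m"
      using m by (simp add: diff_divide_distrib[symmetric] divide_le_eq)
  qed (use r in auto)
  then show "real m * measure M ?E \<le> ?d * real m + 1"
    using haar_unitary_average_le[OF haar large_form_measurable[OF M], of "{..<m}" V]
    by (simp add: V_def line_phase_unitary)
qed

subsection \<open>From quadratic forms to the smallest singular value\<close>

definition polar_vec :: "nat \<Rightarrow> nat \<Rightarrow> complex \<Rightarrow> nat \<Rightarrow> complex" where
  "polar_vec i j z = (\<lambda>l. (if l = j then 1 else 0) + z * (if l = i then 1 else 0))"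

lemma cdot_polar_vec:
  assumes "i < n" "j < n"
  shows "cdot n (polar_vec i j z) y = y j + cnj z * y i"
proof -
  have "cdot n (polar_vec i j z) y
      = (\<Sum>l<n. (if l = j then y l else 0) + (if l = i then cnj z * y l else 0))"
    unfolding cdot_def by (intro sum.cong) (auto simp: polar_vec_def ring_distribs)
  then show ?thesis using assms by (simp add: sum.distrib)
qed

lemma mvec_polar_vec:
  assumes "i < n" "j < n" "k < n"
  shows "mvec n A (polar_vec i j z) k = A k j + z * A k i"
proof -
  have "(\<Sum>l<n. A k l * polar_vec i j z l)
      = (\<Sum>l<n. (if l = j then A k l else 0) + (if l = i then z * A k l else 0))"
    by (intro sum.cong) (auto simp: polar_vec_def ring_distribs)
  then show ?thesis using assms by (simp add: mvec_def sum.distrib)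
qed

text \<open>The value 4 is needed for \<open>i = j\<close>, where the vector is \<open>1 + z\<close>
  times a basis vector; otherwise the squared norm is 2.\<close>

lemma vnorm_polar_vec_le:
  assumes "i < n" "j < n" "cmod z = 1"
  shows "(vnorm n (polar_vec i j z))\<^sup>2 \<le> 4"
proof -
  have "(vnorm n (polar_vec i j z))\<^sup>2 = cmod (cdot n (polar_vec i j z) (polar_vec i j z))"
    by (simp add: cdot_self norm_power)
  also have "\<dots> = cmod (polar_vec i j z j + cnj z * polar_vec i j z i)"
    using assms by (simp add: cdot_polar_vec)
  also have "\<dots> \<le> cmod (polar_vec i j z j) + cmod (polar_vec i j z i)"
    using norm_triangle_ineq[of "polar_vec i j z j" "cnj z * polar_vec i j z i"] assms
    by (simp add: norm_mult)
  also have "\<dots> \<le> 2 + 2"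
    using assms norm_triangle_ineq[of 1 z] by (intro add_mono) (auto simp: polar_vec_def)
  finally show ?thesis by simp
qed

text \<open>Polarization writes \<open>4 * A i j\<close> as a combination of four form values with
  unimodular coefficients, so one of them is at least as large as the entry.\<close>

lemma entry_le_polar_form:
  assumes ij: "i < n" "j < n"
  shows "\<exists>z\<in>{1, - 1, \<i>, - \<i>}.
    cmod (A i j) \<le> cmod (cdot n (polar_vec i j z) (mvec n A (polar_vec i j z)))"
proof (rule ccontr)
  define q where "q z = cdot n (polar_vec i j z) (mvec n A (polar_vec i j z))" for z
  assume "\<not> ?thesis"
  then have less: "cmod (q 1) < cmod (A i j)" "cmod (q (- 1)) < cmod (A i j)"
      "cmod (q \<i>) < cmod (A i j)" "cmod (q (- \<i>)) < cmod (A i j)"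
    by (auto simp: q_def)
  have "4 * A i j = (q 1 - q (- 1)) + \<i> * (q \<i> - q (- \<i>))"
    using ij by (simp add: q_def cdot_polar_vec mvec_polar_vec algebra_simps)
  then have "4 * cmod (A i j) = cmod ((q 1 - q (- 1)) + \<i> * (q \<i> - q (- \<i>)))"
    by (metis norm_mult norm_numeral)
  also have "\<dots> \<le> cmod (q 1 - q (- 1)) + cmod (\<i> * (q \<i> - q (- \<i>)))"
    by (rule norm_triangle_ineq)
  also have "\<dots> \<le> (cmod (q 1) + cmod (q (- 1))) + (cmod (q \<i>) + cmod (q (- \<i>)))"
    by (simp add: norm_mult add_mono norm_triangle_ineq4)
  finally show False using less by linarith
qed

section \<open>From entry bounds to the smallest singular value\<close>

lemma vnorm_eq_L2_set: "vnorm n x = L2_set (\<lambda>i. cmod (x i)) {..<n}"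
  by (simp add: vnorm_def L2_set_def)

text \<open>A crude comparison of the Euclidean norm with the sum of moduli; the lost powers of
  \<open>n\<close> only enlarge the final exponent.\<close>

lemma vnorm_mvec_le:
  assumes "\<And>i j. i < n \<Longrightarrow> j < n \<Longrightarrow> cmod (A i j) \<le> \<rho>" "0 \<le> \<rho>"
  shows "vnorm n (mvec n A x) \<le> (real n)\<^sup>2 * \<rho> * vnorm n x"
proof -
  have "vnorm n (mvec n A x) \<le> (\<Sum>i<n. cmod (mvec n A x i))"
    unfolding vnorm_eq_L2_set by (rule L2_set_le_sum) simp
  also have "\<dots> \<le> (\<Sum>i<n. \<Sum>j<n. \<rho> * vnorm n x)"
  proof (rule sum_mono)
    fix i assume i: "i \<in> {..<n}"
    then have "cmod (mvec n A x i) \<le> (\<Sum>j<n. cmod (A i j * x j))"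
      by (simp add: mvec_def norm_sum)
    also have "\<dots> \<le> (\<Sum>j<n. \<rho> * vnorm n x)"
      using i assms unfolding vnorm_eq_L2_set norm_mult
      by (intro sum_mono mult_mono member_le_L2_set) auto
    finally show "cmod (mvec n A x i) \<le> (\<Sum>j<n. \<rho> * vnorm n x)" .
  qed
  also have "\<dots> = (real n)\<^sup>2 * \<rho> * vnorm n x"
    by (simp add: power2_eq_square)
  finally show ?thesis .
qed

lemma smin_lessE:
  assumes "smin n A < s" "0 < n"
  obtains x where "vnorm n x = 1" "vnorm n (mvec n A x) < s"
proof -
  \<comment> \<open>The first basis vector shows that the infimum is over a nonempty set.\<close>
  have "(\<lambda>i. if i = 0 then 1 else 0) \<in> {x. (\<forall>i\<ge>n. x i = 0) \<and> vnorm n x = 1}"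
  proof -
    have "(\<Sum>i<n. (cmod (if i = 0 then 1 else 0))\<^sup>2) = (\<Sum>i<n. if i = 0 then 1 else (0::real))"
      by (intro sum.cong) auto
    then show ?thesis using assms(2) by (auto simp: vnorm_def)
  qed
  then have "(\<lambda>x. vnorm n (mvec n A x)) ` {x. (\<forall>i\<ge>n. x i = 0) \<and> vnorm n x = 1} \<noteq> {}"
    unfolding image_is_empty by (rule ex_in_conv[THEN iffD1, OF exI])
  from cInf_lessD[OF this assms(1)[unfolded smin_def]]
  obtain x where "vnorm n x = 1" "vnorm n (mvec n A x) < s" by auto
  then show thesis by (rule that)
qed

text \<open>If all entries of \<open>U adj(A)\<close> were small, applying it to \<open>A x\<close>
  for a unit vector \<open>x\<close> with \<open>A x\<close> short would give a vector of norm below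
  \<open>cmod (mdet n A)\<close>, but \<open>adj(A) A x = mdet n A * x\<close> and \<open>U\<close>
  is an isometry.\<close>

lemma large_entry_of_small_smin:
  assumes U: "U \<in> unitary n" and n: "0 < n" and t: "0 < t" and d: "mdet n (madd n D U) \<noteq> 0"
    and small: "smin n (madd n D U) \<le> t"
  shows "\<exists>i<n. \<exists>j<n. 1 / (2 * (real n)\<^sup>2 * t) * cmod (mdet n (madd n D U))
    \<le> cmod (mmult n U (madj n (madd n D U)) i j)"
proof (rule ccontr)
  define A where "A = madd n D U"
  define \<rho> where "\<rho> = 1 / (2 * (real n)\<^sup>2 * t) * cmod (mdet n A)"
  assume "\<not> ?thesis"
  then have *: "cmod (mmult n U (madj n A) i j) \<le> \<rho>" if "i < n" "j < n" for i j
    using that by (force simp: \<rho>_def A_def)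
  have \<rho>: "0 < \<rho>" using n t d by (simp add: \<rho>_def A_def)
  \<comment> \<open>Doubling \<open>t\<close> makes the inequality strict, so a suitable unit vector
    exists without knowing that the infimum is attained; this is the 2 in the threshold.\<close>
  from small t have "smin n A < 2 * t" by (simp add: A_def)
  then obtain x where x: "vnorm n x = 1" "vnorm n (mvec n A x) < 2 * t"
    using n by (rule smin_lessE)
  have "mvec n (mmult n U (madj n A)) (mvec n A x) = mvec n U (\<lambda>i. mdet n A * x i)"
    unfolding mvec_mmult by (rule mvec_cong) (rule mvec_madj_left)
  then have "vnorm n (mvec n (mmult n U (madj n A)) (mvec n A x)) = vnorm n (\<lambda>i. mdet n A * x i)"
    by (simp add: vnorm_mvec_unitary[OF U])
  also have "\<dots> = cmod (mdet n A)"
    using x(1) by (simp add: vnorm_def norm_mult power_mult_distrib sum_distrib_left[symmetric]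
        real_sqrt_mult)
  finally have "cmod (mdet n A) \<le> (real n)\<^sup>2 * \<rho> * vnorm n (mvec n A x)"
    using vnorm_mvec_le[of n "mmult n U (madj n A)" \<rho> "mvec n A x"] * \<rho> by simp
  also have "\<dots> < (real n)\<^sup>2 * \<rho> * (2 * t)"
    using x(2) \<rho> n by (intro mult_strict_left_mono) auto
  also have "\<dots> = cmod (mdet n A)"
    using n t by (simp add: \<rho>_def)
  finally show False by simp
qed

text \<open>Union bound over the null set and \<open>4 * n^2\<close> events, each of probability at
  most \<open>8 / r\<close> with \<open>1 / r = 2 * n^2 * t\<close>; the product is
  \<open>64 * n^4 * t\<close>.\<close>

lemma haar_smin_le:
  assumes haar: "haar_unitary n M" and n: "0 < n" and t: "0 < t"
  shows "measure M {U \<in> space M. smin n (madd n D U) \<le> t} \<le> 64 * real n ^ 4 * t"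
proof -
  interpret prob_space M using haar by (simp add: haar_unitary_def)
  have M: "sets M = sets borel" "AE U in M. U \<in> unitary n"
    using haar by (auto simp: haar_unitary_def)
  define r where "r = 1 / (2 * (real n)\<^sup>2 * t)"
  have r: "0 < r" using n t by (simp add: r_def)
  define I where "I = {..<n} \<times> {..<n} \<times> {1, - 1, \<i>, - \<i>}"
  define L where "L = (\<lambda>(i, j, z). large_form n D (polar_vec i j z) r)"
  define Z where "Z = {U. mdet n (madd n D U) = 0}"
  have I: "finite I" by (simp add: I_def)
  have L: "L ` I \<subseteq> sets M" by (auto simp: L_def large_form_measurable[OF M(1)])
  have Z: "Z \<in> sets M" "measure M Z = 0"
    using haar_singular_null[OF haar, of D] by (auto simp: Z_def)
  have "measure M {U \<in> space M. smin n (madd n D U) \<le> t} \<le> measure M (Z \<union> (\<Union>p\<in>I. L p))"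
  proof (rule finite_measure_mono_AE)
    show "AE U in M. U \<in> {U \<in> space M. smin n (madd n D U) \<le> t} \<longrightarrow> U \<in> Z \<union> (\<Union>p\<in>I. L p)"
      using M(2)
    proof eventually_elim
      case (elim U)
      show ?case
      proof (intro impI, rule ccontr)
        let ?A = "madd n D U"
        assume S: "U \<in> {U \<in> space M. smin n (madd n D U) \<le> t}"
          and not: "U \<notin> Z \<union> (\<Union>p\<in>I. L p)"
        then have d: "mdet n ?A \<noteq> 0" by (auto simp: Z_def)
        obtain i j where ij: "i < n" "j < n"
          and big: "r * cmod (mdet n ?A) \<le> cmod (mmult n U (madj n ?A) i j)"
          using large_entry_of_small_smin[OF elim n t d] S by (auto simp: r_def)
        obtain z where z: "z \<in> {1, - 1, \<i>, - \<i>}" "cmod (mmult n U (madj n ?A) i j)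
            \<le> cmod (cdot n (polar_vec i j z) (mvec n (mmult n U (madj n ?A)) (polar_vec i j z)))"
          using entry_le_polar_form[OF ij] by blast
        have "U \<in> L (i, j, z)"
          using d big z(2) by (simp add: L_def large_form_def mvec_mmult)
        moreover have "(i, j, z) \<in> I" using ij z(1) by (simp add: I_def)
        ultimately show False using not by blast
      qed
    qed
    show "Z \<union> (\<Union>p\<in>I. L p) \<in> sets M" using Z(1) L I by auto
  qed
  also have "\<dots> \<le> measure M Z + measure M (\<Union>p\<in>I. L p)"
    using Z(1) L I by (intro measure_Un_le) auto
  also have "\<dots> \<le> (\<Sum>p\<in>I. measure M (L p))"
    using finite_measure_subadditive_finite[OF I L] Z(2) by simp
  also have "\<dots> \<le> (\<Sum>p\<in>I. 8 / r)"
  proof (rule sum_mono)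
    fix p assume "p \<in> I"
    then obtain i j z where p: "p = (i, j, z)" "i < n" "j < n" "cmod z = 1"
      by (auto simp: I_def)
    have "measure M (L p) \<le> 2 * (vnorm n (polar_vec i j z))\<^sup>2 / r"
      using haar_large_form_le[OF haar r] by (simp add: L_def p(1))
    also have "\<dots> \<le> 2 * 4 / r"
      using r p vnorm_polar_vec_le[of i n j z] by (intro divide_right_mono mult_left_mono) auto
    finally show "measure M (L p) \<le> 8 / r" by simp
  qed
  also have "\<dots> = real (card I) * (8 / r)" by simp
  also have "card I = 4 * n\<^sup>2"
    by (simp add: I_def card_cartesian_product complex_eq_iff power2_eq_square)
  also have "real (4 * n\<^sup>2) * (8 / r) = 64 * real n ^ 4 * t"
    using t n by (simp add: r_def field_simps power2_eq_square power4_eq_xxxx)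
  finally show ?thesis .
qed

theorem theorem9p1:
  shows "\<exists>c C :: real. c > 0 \<and> C > 0 \<and>
    (\<forall>n \<ge> 2. \<forall>D M. \<forall>t :: real.
       D \<in> cmat n \<longrightarrow> haar_unitary n M \<longrightarrow> t > 0 \<longrightarrow>
       measure M {U \<in> space M. smin n (madd n D U) \<le> t} \<le> t powr c * real n powr C)"
\<comment> \<open>Since \<open>n\<close> is at least 2, the constant \<open>64 = 2 ^ 6\<close> is
  absorbed into \<open>n ^ 6\<close>, which with \<open>n ^ 4\<close> gives the exponent 10.\<close>
proof (rule exI[of _ 1], rule exI[of _ 10], intro conjI allI impI)
  fix n :: nat and D M and t :: real
  assume n: "2 \<le> n" and haar: "haar_unitary n M" and t: "0 < t"
  have "measure M {U \<in> space M. smin n (madd n D U) \<le> t} \<le> 2 ^ 6 * real n ^ 4 * t"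
    using haar_smin_le[OF haar _ t, of D] n by simp
  also have "\<dots> \<le> real n ^ 6 * real n ^ 4 * t"
    using n t by (intro mult_right_mono power_mono) auto
  also have "\<dots> = t powr 1 * real n powr 10"
    using n t by (simp add: power_add[symmetric] powr_numeral mult.commute)
  finally show "measure M {U \<in> space M. smin n (madd n D U) \<le> t} \<le> t powr 1 * real n powr 10" .
qed simp_all

end
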